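(* Let $X=(a_1,\dots,a_N)$ be a finite list of nonzero vectors spanning the $s$-dimensional vector space $V$. Let $D_k(X)$ denote the homogeneous component of degree $k$ of the graded space $D(X)$, and set $H_X(q):=\sum_k \dim(D_k(X))\,q^k$. Then $$H_X(q)=\sum_{\underline b\in\mathcal B(X)}q^{N-n(\underline b)} .$$
   Context: $V$ is an $s$-dimensional complex vector space, $U=V^*$ its dual, $S[U]$ the algebra of polynomial functions on $V$. For $v\in V$, $D_v$ is the directional derivative on $S[U]$. $X=(a_1,\dots,a_N)$ is an ordered list of nonzero vectors (repetitions allowed) spanning $V$; sublists are identified with sets of indices. A sublist $Y\subset X$ is a cocircuit if the elements of $X-Y$ do not span $V$; $\mathcal E(X)$ is the set of cocircuits. For $Y\subset X$ put $D_Y:=\prod_{x\in Y}D_x$. Define $D(X):=\{p\in S[U] \mid D_Yp=0\ \forall\, Y\in\mathcal E(X)\}$, which is graded by polynomial degree. $\mathcal B(X)$ is the set of all bases of $V$ extracted from $X$, i.e. sublists $\underline b=(a_{i_1},\dots,a_{i_s})$, $i_1<\dots<i_s$, which are bases of $V$ (sublists with different index sets are counted as different). An element $a_i$ of $X$ breaks $\underline b=(a_{i_1},\dots,a_{i_s})$ if there is an index $1\le e\le s$ such that $i\le i_e$ and $a_i$ is linearly dependent on $a_{i_e},\dots,a_{i_s}$ (lies in their span). $B(\underline b)$ is the sublist of elements of $X$ (counted by index) that break $\underline b$, and $n(\underline b):=|B(\underline b)|$. *)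

theory Defs
  imports
    "HOL-Analysis.Analysis"
    "HOL-Library.Function_Algebras"
    "HOL-Computational_Algebra.Formal_Power_Series"
begin

text \<open>
  Throughout, a complex vector space \<open>V\<close> is a type \<open>'v\<close> together with a scalar multiplication
  \<open>smult_V\<close> such that \<^term>\<open>vector_space smult_V\<close> holds.  Functions \<open>'v \<Rightarrow> complex\<close> carry the pointwise
  ring structure of \<^theory>\<open>HOL-Library.Function_Algebras\<close> and the following scalar multiplication.
\<close>

definition fscale :: "complex \<Rightarrow> ('v \<Rightarrow> complex) \<Rightarrow> ('v \<Rightarrow> complex)" where
  "fscale c p = (\<lambda>x. c * p x)"

lemma vector_space_fscale: "vector_space fscale"
  by unfold_locales (auto simp: fscale_def fun_eq_iff algebra_simps)

definition dual_space :: "(complex \<Rightarrow> 'v::ab_group_add \<Rightarrow> 'v) \<Rightarrow> ('v \<Rightarrow> complex) set" where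
  "dual_space smult_V = {f. Vector_Spaces.linear smult_V (*) f}"

text \<open>\<open>S[U]\<close>: the algebra of functions on \<open>V\<close> generated by the dual space \<open>U\<close>.\<close>

inductive_set poly_functions ::
    "(complex \<Rightarrow> 'v::ab_group_add \<Rightarrow> 'v) \<Rightarrow> ('v \<Rightarrow> complex) set"
  for smult_V :: "complex \<Rightarrow> 'v \<Rightarrow> 'v" where
  const: "(\<lambda>_. c) \<in> poly_functions smult_V"
| linear: "f \<in> dual_space smult_V \<Longrightarrow> f \<in> poly_functions smult_V"
| add: "p \<in> poly_functions smult_V \<Longrightarrow> q \<in> poly_functions smult_V \<Longrightarrow> p + q \<in> poly_functions smult_V"
| mult: "p \<in> poly_functions smult_V \<Longrightarrow> q \<in> poly_functions smult_V \<Longrightarrow> p * q \<in> poly_functions smult_V"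

text \<open>The component of degree \<open>k\<close> of \<open>S[U]\<close>: linear combinations of \<open>k\<close>-fold products of elements
  of \<open>U\<close>.\<close>

definition hom_poly_functions ::
    "(complex \<Rightarrow> 'v::ab_group_add \<Rightarrow> 'v) \<Rightarrow> nat \<Rightarrow> ('v \<Rightarrow> complex) set" where
  "hom_poly_functions smult_V k =
     module.span fscale {\<lambda>x. \<Prod>i<k. f i x | f. \<forall>i<k. f i \<in> dual_space smult_V}"

definition dir_deriv ::
    "(complex \<Rightarrow> 'v::ab_group_add \<Rightarrow> 'v) \<Rightarrow> 'v \<Rightarrow> ('v \<Rightarrow> complex) \<Rightarrow> ('v \<Rightarrow> complex)" where
  "dir_deriv smult_V v p = (\<lambda>x. deriv (\<lambda>t. p (x + smult_V t v)) 0)"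

text \<open>\<open>D\<^sub>Y\<close>, as a composition of operators; on polynomial functions the factors commute, so that
  their order is irrelevant.\<close>

definition dir_derivs ::
    "(complex \<Rightarrow> 'v::ab_group_add \<Rightarrow> 'v) \<Rightarrow> 'v list \<Rightarrow> ('v \<Rightarrow> complex) \<Rightarrow> ('v \<Rightarrow> complex)" where
  "dir_derivs smult_V Y = foldr (dir_deriv smult_V) Y"

text \<open>
  A sublist of \<open>X\<close> is given by its set \<open>I\<close> of (0-based) positions; the sublist itself is
  \<^term>\<open>nths X I\<close>.
\<close>

definition cocircuits :: "(complex \<Rightarrow> 'v::ab_group_add \<Rightarrow> 'v) \<Rightarrow> 'v list \<Rightarrow> nat set set" where
  "cocircuits smult_V X =
     {I. I \<subseteq> {..<length X} \<and> module.span smult_V (set (nths X ({..<length X} - I))) \<noteq> UNIV}"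

definition D_space :: "(complex \<Rightarrow> 'v::ab_group_add \<Rightarrow> 'v) \<Rightarrow> 'v list \<Rightarrow> ('v \<Rightarrow> complex) set" where
  "D_space smult_V X =
     {p \<in> poly_functions smult_V. \<forall>I\<in>cocircuits smult_V X. dir_derivs smult_V (nths X I) p = 0}"

definition D_hom ::
    "(complex \<Rightarrow> 'v::ab_group_add \<Rightarrow> 'v) \<Rightarrow> 'v list \<Rightarrow> nat \<Rightarrow> ('v \<Rightarrow> complex) set" where
  "D_hom smult_V X k = D_space smult_V X \<inter> hom_poly_functions smult_V k"

definition hilbert_series :: "(complex \<Rightarrow> 'v::ab_group_add \<Rightarrow> 'v) \<Rightarrow> 'v list \<Rightarrow> int fps" where
  "hilbert_series smult_V X = Abs_fps (\<lambda>k. int (vector_space.dim fscale (D_hom smult_V X k)))"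

definition extracted_bases :: "(complex \<Rightarrow> 'v::ab_group_add \<Rightarrow> 'v) \<Rightarrow> 'v list \<Rightarrow> nat set set" where
  "extracted_bases smult_V X =
     {I. I \<subseteq> {..<length X} \<and> distinct (nths X I) \<and>
         \<not> module.dependent smult_V (set (nths X I)) \<and>
         module.span smult_V (set (nths X I)) = UNIV}"

text \<open>
  For \<open>I = {i\<^sub>1 < \<dots> < i\<^sub>s}\<close>, the variable \<open>j\<close> below runs over the possible \<open>i\<^sub>e\<close>, and
  \<^term>\<open>{l \<in> I. j \<le> l}\<close> is \<open>{i\<^sub>e, \<dots>, i\<^sub>s}\<close>.
\<close>

definition breaking ::
    "(complex \<Rightarrow> 'v::ab_group_add \<Rightarrow> 'v) \<Rightarrow> 'v list \<Rightarrow> nat set \<Rightarrow> nat set" where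
  "breaking smult_V X I =
     {i. i < length X \<and>
         (\<exists>j\<in>I. i \<le> j \<and> X ! i \<in> module.span smult_V (set (nths X {l \<in> I. j \<le> l})))}"

end

(*
  Upper bound: an element p of D(X) vanishes as soon as the derivatives of p along the unbroken
  elements of every basis b vanish at 0; this follows by deleting and contracting the last vector
  a_N, because the bases avoiding a_N contribute functionals of D_{a_N} p and those containing a_N
  contribute the functionals of the contraction.  As the functional of b has degree N - n(b), the
  dimension of D_k(X) is at most the number of b with N - n(b) = k.

  Lower bound: choose generic numbers l_i and let f_b in U take the value l_i at a_i for i in b.
  Every product of the (D_{a_i} - l_i) over a cocircuit annihilates the exponentials exp(f_b), so
  the lowest homogeneous component of a linear combination of them lies in D(X).  The f_b are
  distinct, hence the exponentials are independent and the dimensions of the D_k(X) add up to at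
  least the number of bases.
*)

theory Submission
  imports Defs
begin

section \<open>Linear algebra: underdetermined systems and separating functionals\<close>

text \<open>Gaussian elimination: an equation with a nonzero coefficient at \<open>b0\<close> is
  solved for the unknown \<open>b0\<close>, which is then substituted into the remaining
  equations.\<close>

lemma exists_nontrivial_solution:
  fixes a :: "'e \<Rightarrow> 'b \<Rightarrow> 'f::field"
  assumes "finite E" "finite B" "card E < card B"
  shows "\<exists>c. (\<exists>b\<in>B. c b \<noteq> 0) \<and> (\<forall>e\<in>E. (\<Sum>b\<in>B. c b * a e b) = 0)"
  using assms
proof (induction E arbitrary: B a rule: finite_induct)
  case empty
  then have "B \<noteq> {}" by auto
  then show ?case by (intro exI[of _ "\<lambda>_. 1"]) auto
next
  case (insert e E)
  show ?case
  proof (cases "\<forall>b\<in>B. a e b = 0")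
    case True
    with insert.IH[of B a] insert.prems insert.hyps show ?thesis by auto
  next
    case False
    then obtain b0 where b0: "b0 \<in> B" "a e b0 \<noteq> 0" by blast
    define B' where "B' = B - {b0}"
    have B': "finite B'" "card E < card B'"
      using insert b0 by (auto simp: B'_def)
    have B_eq: "B = insert b0 B'" "b0 \<notin> B'" using b0 by (auto simp: B'_def)
    from insert.IH[OF B', of "\<lambda>f b. a f b - a f b0 * (a e b / a e b0)"] obtain c
      where c: "\<exists>b\<in>B'. c b \<noteq> 0"
        "\<And>f. f \<in> E \<Longrightarrow> (\<Sum>b\<in>B'. c b * (a f b - a f b0 * (a e b / a e b0))) = 0"
      by auto
    \<comment> \<open>Solving equation \<open>e\<close> for the eliminated unknown gives it the
      value \<open>- s\<close>.\<close>
    define s where "s = (\<Sum>b\<in>B'. c b * a e b) / a e b0"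
    define c' where "c' = c(b0 := - s)"
    have sum_c': "(\<Sum>b\<in>B. c' b * a f b) = (\<Sum>b\<in>B'. c b * a f b) - s * a f b0" for f
    proof -
      have "(\<Sum>b\<in>B'. c' b * a f b) = (\<Sum>b\<in>B'. c b * a f b)"
        using B_eq(2) by (intro sum.cong) (auto simp: c'_def)
      then show ?thesis using B'(1) B_eq by (simp add: c'_def)
    qed
    have "(\<Sum>b\<in>B. c' b * a e b) = 0"
      using b0 by (simp add: sum_c' s_def)
    moreover have "(\<Sum>b\<in>B. c' b * a f b) = 0" if "f \<in> E" for f
    proof -
      have "(\<Sum>b\<in>B'. c b * (a f b - a f b0 * (a e b / a e b0))) =
          (\<Sum>b\<in>B'. c b * a f b) - s * a f b0"
        by (simp add: s_def sum_divide_distrib sum_distrib_right sum_distrib_left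
            right_diff_distrib sum_subtractf mult_ac)
      with c(2)[OF that] show ?thesis by (simp add: sum_c')
    qed
    moreover have "\<exists>b\<in>B. c' b \<noteq> 0" using c(1) B_eq by (auto simp: c'_def)
    ultimately show ?thesis by (intro exI[of _ c']) auto
  qed
qed

text \<open>A relation between the value vectors of more than \<open>card E\<close> elements is a
  relation between the elements, because the functionals separate points. Linearity is asked only on
  \<open>S\<close>, since derivatives are linear only on differentiable functions. Finiteness of
  \<open>B\<close> is part of the conclusion because \<open>card\<close> is 0 on infinite
  sets.\<close>

lemma (in vector_space) independent_card_le_separating:
  fixes \<phi> :: "'e \<Rightarrow> 'b \<Rightarrow> 'a"
  assumes S: "subspace S" and E: "finite E"
    and add: "\<And>e x y. e \<in> E \<Longrightarrow> x \<in> S \<Longrightarrow> y \<in> S \<Longrightarrow> \<phi> e (x + y) = \<phi> e x + \<phi> e y"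
    and scl: "\<And>e c x. e \<in> E \<Longrightarrow> x \<in> S \<Longrightarrow> \<phi> e (c *s x) = c * \<phi> e x"
    and sep: "\<And>x. x \<in> S \<Longrightarrow> (\<And>e. e \<in> E \<Longrightarrow> \<phi> e x = 0) \<Longrightarrow> x = 0"
    and B: "B \<subseteq> S" "independent B"
  shows "finite B \<and> card B \<le> card E"
proof (rule ccontr)
  assume "\<not> (finite B \<and> card B \<le> card E)"
  then obtain T where T: "T \<subseteq> B" "finite T" "card E < card T"
  proof (cases "finite B")
    case False
    then obtain T where "T \<subseteq> B" "finite T" "card T = Suc (card E)"
      using infinite_arbitrarily_large by blast
    with that show ?thesis by simp
  qed (use that[of B] in simp)
  from exists_nontrivial_solution[OF E T(2,3), of \<phi>] obtain c
    where c: "\<exists>b\<in>T. c b \<noteq> 0" "\<And>e. e \<in> E \<Longrightarrow> (\<Sum>b\<in>T. c b * \<phi> e b) = 0"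
    by auto
  have TS: "T \<subseteq> S" using T B by auto
  have sumS: "(\<Sum>b\<in>T'. c b *s b) \<in> S" if "T' \<subseteq> S" for T'
    using that by (intro subspace_sum[OF S] subspace_scale[OF S]) auto
  have "\<phi> e (\<Sum>b\<in>T. c b *s b) = (\<Sum>b\<in>T. c b * \<phi> e b)" if e: "e \<in> E" for e
    using T(2) TS
  proof (induction T rule: finite_induct)
    case empty
    show ?case using scl[OF e subspace_0[OF S], of 0] by simp
  next
    case (insert b T)
    then show ?case
      using sumS[of T] subspace_scale[OF S] by (simp add: add[OF e] scl[OF e])
  qed
  then have "(\<Sum>b\<in>T. c b *s b) = 0" using c(2) sumS[OF TS] by (intro sep) auto
  moreover have "independent T" using B T independent_mono by blast
  ultimately show False using c(1) T(2) dependent_finite by blast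
qed

text \<open>Indexing the sublist by positions lets an induction on the length of the list peel off
  its last vector.\<close>

lemma nths_eq_map_filter:
  "nths X I = map ((!) X) (filter (\<lambda>i. i \<in> I) [0..<length X])"
proof (induction X rule: rev_induct)
  case (snoc x X)
  have "map ((!) (X @ [x])) (filter (\<lambda>i. i \<in> I) [0..<length X]) =
      map ((!) X) (filter (\<lambda>i. i \<in> I) [0..<length X])"
    by (intro map_cong) (auto simp: nth_append)
  with snoc show ?case by (simp add: nths_append)
qed simp

section \<open>Polynomial functions and directional derivatives\<close>

interpretation fs: vector_space fscale
  by (rule vector_space_fscale)

locale complex_vector_space = vector_space scale
  for scale :: "complex \<Rightarrow> 'v::ab_group_add \<Rightarrow> 'v"
begin

abbreviation "P \<equiv> poly_functions scale"
abbreviation "DD \<equiv> dir_deriv scale"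

lemma dual_add: "f \<in> dual_space scale \<Longrightarrow> f (x + y) = f x + f y"
  and dual_scale: "f \<in> dual_space scale \<Longrightarrow> f (scale c x) = c * f x"
  by (auto simp: dual_space_def Vector_Spaces.linear_iff)

text \<open>Since \<open>deriv\<close> has an arbitrary value where no derivative exists, existence
  comes first. A single polynomial \<open>p'\<close> serves all base points and all
  \<open>t\<close>.\<close>

lemma poly_has_deriv:
  assumes "p \<in> P"
  shows "\<exists>p'\<in>P. \<forall>x t. ((\<lambda>t. p (x + scale t v)) has_field_derivative p' (x + scale t v)) (at t)"
  using assms
proof induction
  case (const c)
  show ?case by (intro bexI[of _ "\<lambda>_. 0"] poly_functions.const) auto
next
  case (linear f)
  then show ?case
    by (intro bexI[of _ "\<lambda>_. f v"] poly_functions.const)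
      (auto simp: dual_add dual_scale intro!: derivative_eq_intros)
next
  case (add p q)
  then obtain p' q' where
    "p' \<in> P" "\<And>x t. ((\<lambda>t. p (x + scale t v)) has_field_derivative p' (x + scale t v)) (at t)"
    "q' \<in> P" "\<And>x t. ((\<lambda>t. q (x + scale t v)) has_field_derivative q' (x + scale t v)) (at t)"
    by blast
  then show ?case
    by (intro bexI[of _ "p' + q'"] poly_functions.add) (auto intro!: derivative_intros)
next
  case (mult p q)
  then obtain p' q' where
    "p' \<in> P" "\<And>x t. ((\<lambda>t. p (x + scale t v)) has_field_derivative p' (x + scale t v)) (at t)"
    "q' \<in> P" "\<And>x t. ((\<lambda>t. q (x + scale t v)) has_field_derivative q' (x + scale t v)) (at t)"
    by blast
  with mult show ?case
    by (intro bexI[of _ "p' * q + q' * p"] poly_functions.add poly_functions.mult)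
      (auto intro!: derivative_eq_intros)
qed

lemma dir_deriv_eqI:
  assumes "\<And>x. ((\<lambda>t. p (x + scale t v)) has_field_derivative p' x) (at 0)"
  shows "DD v p = p'"
  unfolding dir_deriv_def using assms by (intro ext DERIV_imp_deriv)

lemma
  assumes "p \<in> P"
  shows dir_deriv_poly: "DD v p \<in> P"
    and has_dir_deriv: "((\<lambda>t. p (x + scale t v)) has_field_derivative DD v p (x + scale t v)) (at t)"
proof -
  obtain p' where p': "p' \<in> P"
    "\<And>x t. ((\<lambda>t. p (x + scale t v)) has_field_derivative p' (x + scale t v)) (at t)"
    using poly_has_deriv[OF assms] by blast
  have "DD v p = p'" using p'(2)[where t = 0] by (intro dir_deriv_eqI) simp
  with p' show "DD v p \<in> P"
    "((\<lambda>t. p (x + scale t v)) has_field_derivative DD v p (x + scale t v)) (at t)" by auto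
qed

lemma has_dir_deriv_0:
  "p \<in> P \<Longrightarrow> ((\<lambda>t. p (x + scale t v)) has_field_derivative DD v p x) (at 0)"
  using has_dir_deriv[of p x v 0] by simp

lemma dir_deriv_const: "DD v (\<lambda>_. c) = 0"
  by (intro dir_deriv_eqI) auto

lemma dir_deriv_0 [simp]: "DD v 0 = 0"
  using dir_deriv_const[of v 0] by (simp add: zero_fun_def)

lemma dir_deriv_dual: "f \<in> dual_space scale \<Longrightarrow> DD v f = (\<lambda>_. f v)"
  by (intro dir_deriv_eqI) (auto simp: dual_add dual_scale intro!: derivative_eq_intros)

lemma dir_deriv_add: "p \<in> P \<Longrightarrow> q \<in> P \<Longrightarrow> DD v (p + q) = DD v p + DD v q"
  by (intro dir_deriv_eqI) (auto intro!: derivative_intros has_dir_deriv_0)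

lemma dir_deriv_mult: "p \<in> P \<Longrightarrow> q \<in> P \<Longrightarrow> DD v (p * q) = DD v p * q + p * DD v q"
  by (intro dir_deriv_eqI) (auto intro!: derivative_eq_intros has_dir_deriv_0)

lemma fscale_eq_mult: "fscale c p = (\<lambda>_. c) * p"
  by (simp add: fscale_def fun_eq_iff)

lemma poly_fscale: "p \<in> P \<Longrightarrow> fscale c p \<in> P"
  by (simp add: fscale_eq_mult poly_functions.intros)

lemma poly_0: "0 \<in> P"
  using poly_functions.const[of 0 scale] by (simp add: zero_fun_def)

lemma dir_deriv_fscale: "p \<in> P \<Longrightarrow> DD v (fscale c p) = fscale c (DD v p)"
  by (simp add: fscale_eq_mult dir_deriv_mult poly_functions.const dir_deriv_const)

lemma dir_deriv_commute: "p \<in> P \<Longrightarrow> DD v (DD w p) = DD w (DD v p)"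
proof (induction rule: poly_functions.induct)
  case (add p q)
  then show "DD v (DD w (p + q)) = DD w (DD v (p + q))"
    by (simp add: dir_deriv_add dir_deriv_poly)
next
  case (mult p q)
  then show "DD v (DD w (p * q)) = DD w (DD v (p * q))"
    by (simp add: dir_deriv_mult dir_deriv_add dir_deriv_poly poly_functions.mult)
qed (simp_all add: dir_deriv_const dir_deriv_dual)

lemma dir_deriv_vec_add: "p \<in> P \<Longrightarrow> DD (v + w) p = DD v p + DD w p"
proof (induction rule: poly_functions.induct)
  case (linear f)
  then show ?case by (simp add: dir_deriv_dual dual_add fun_eq_iff)
next
  case (add p q)
  then show "DD (v + w) (p + q) = DD v (p + q) + DD w (p + q)"
    by (simp add: dir_deriv_add fun_eq_iff)
next
  case (mult p q)
  then show "DD (v + w) (p * q) = DD v (p * q) + DD w (p * q)"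
    by (simp add: dir_deriv_mult) (simp add: fun_eq_iff algebra_simps)
qed (simp add: dir_deriv_const)

lemma dir_deriv_vec_scale: "p \<in> P \<Longrightarrow> DD (scale c v) p = fscale c (DD v p)"
proof (induction rule: poly_functions.induct)
  case (linear f)
  then show ?case by (simp add: dir_deriv_dual dual_scale fun_eq_iff fscale_def)
next
  case (const d)
  show "DD (scale c v) (\<lambda>_. d) = fscale c (DD v (\<lambda>_. d))"
    by (simp add: dir_deriv_const)
next
  case (add p q)
  then show "DD (scale c v) (p + q) = fscale c (DD v (p + q))"
    by (simp add: dir_deriv_add fs.scale_right_distrib)
next
  case (mult p q)
  then show "DD (scale c v) (p * q) = fscale c (DD v (p * q))"
    by (simp add: dir_deriv_mult) (simp add: fscale_def fun_eq_iff algebra_simps)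
qed

text \<open>The derivative is linear in the direction, so the directions that annihilate
  \<open>p\<close> form a subspace.\<close>

lemma dir_deriv_span_eq_0:
  assumes p: "p \<in> P" and W: "\<And>w. w \<in> W \<Longrightarrow> DD w p = 0" and v: "v \<in> span W"
  shows "DD v p = 0"
proof -
  have "subspace {v. DD v p = 0}"
    using dir_deriv_vec_scale[OF p, of 0]
    by (auto simp: subspace_def dir_deriv_vec_add[OF p] dir_deriv_vec_scale[OF p] fs.scale_zero_left)
  with W v show ?thesis using span_minimal[of W "{v. DD v p = 0}"] by auto
qed

lemma poly_eq_const:
  assumes p: "p \<in> P" and D: "\<And>v. DD v p = 0"
  shows "p = (\<lambda>_. p 0)"
proof
  fix x
  have "((\<lambda>t. p (0 + scale t x)) has_field_derivative 0) (at t)" for t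
    using has_dir_deriv[OF p, of 0 x t] D[of x] by simp
  then obtain c where "\<And>t. p (0 + scale t x) = c"
    using has_field_derivative_zero_constant[of UNIV "\<lambda>t. p (0 + scale t x)"] by auto
  from this[of 0] this[of 1] show "p x = p 0" by simp
qed

section \<open>Iterated derivatives and homogeneity\<close>

lemma dir_derivs_simps:
  "dir_derivs scale [] p = p" "dir_derivs scale (v # Y) p = DD v (dir_derivs scale Y p)"
  "dir_derivs scale (Y @ Z) p = dir_derivs scale Y (dir_derivs scale Z p)"
  by (simp_all add: dir_derivs_def)

lemma dir_derivs_poly: "p \<in> P \<Longrightarrow> dir_derivs scale Y p \<in> P"
  by (induction Y) (auto simp: dir_derivs_simps dir_deriv_poly)

lemma dir_derivs_add:
  "p \<in> P \<Longrightarrow> q \<in> P \<Longrightarrow> dir_derivs scale Y (p + q) = dir_derivs scale Y p + dir_derivs scale Y q"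
  by (induction Y) (auto simp: dir_derivs_simps dir_deriv_add dir_derivs_poly)

lemma dir_derivs_fscale:
  "p \<in> P \<Longrightarrow> dir_derivs scale Y (fscale c p) = fscale c (dir_derivs scale Y p)"
  by (induction Y) (auto simp: dir_derivs_simps dir_deriv_fscale dir_derivs_poly)

lemma dir_derivs_0: "dir_derivs scale Y 0 = 0"
  using dir_derivs_fscale[OF poly_0, of Y 0] by simp

lemma hom_poly_subspace: "fs.subspace (hom_poly_functions scale k)"
  by (simp add: hom_poly_functions_def)

lemma poly_subspace: "fs.subspace P"
  by (auto simp: fs.subspace_def poly_0 poly_fscale poly_functions.add)

lemma hom_poly_functions_subset: "hom_poly_functions scale k \<subseteq> P"
proof -
  have "(\<lambda>x. \<Prod>i<k. f i x) \<in> P" if "\<forall>i<k. f i \<in> dual_space scale" for f :: "nat \<Rightarrow> 'v \<Rightarrow> complex"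
    using that
  proof (induction k)
    case 0
    show ?case using poly_functions.const[of 1] by simp
  next
    case (Suc k)
    have "(\<lambda>x. \<Prod>i<Suc k. f i x) = (\<lambda>x. \<Prod>i<k. f i x) * f k" by auto
    with Suc show ?case by (auto intro!: poly_functions.mult intro: poly_functions.linear)
  qed
  then show ?thesis
    unfolding hom_poly_functions_def by (intro fs.span_minimal poly_subspace) auto
qed

lemma hom_poly_scale:
  assumes "p \<in> hom_poly_functions scale k"
  shows "p (scale c x) = c ^ k * p x"
proof -
  have "fs.subspace {p. p (scale c x) = c ^ k * p x}"
    by (auto simp: fs.subspace_def fscale_def algebra_simps)
  moreover have "{\<lambda>x. \<Prod>i<k. f i x | f. \<forall>i<k. f i \<in> dual_space scale} \<subseteq> {p. p (scale c x) = c ^ k * p x}"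
    by (auto simp: dual_scale prod.distrib)
  ultimately show ?thesis using assms fs.span_minimal unfolding hom_poly_functions_def by blast
qed

text \<open>Each derivative lowers the degree of homogeneity by one. The powers stand on both sides
  so that the identity also makes sense when \<open>length Y\<close> exceeds
  \<open>k\<close>.\<close>

lemma dir_derivs_hom_scale:
  assumes p: "p \<in> P" and hom: "\<And>x. p (scale c x) = c ^ k * p x" and c: "c \<noteq> 0"
  shows "c ^ length Y * dir_derivs scale Y p (scale c x) = c ^ k * dir_derivs scale Y p x"
proof (induction Y arbitrary: x)
  case Nil
  show ?case by (simp add: dir_derivs_simps hom)
next
  case (Cons v Y)
  let ?q = "dir_derivs scale Y p"
  have q: "?q \<in> P" using p by (rule dir_derivs_poly)
  have "((\<lambda>t. c ^ k * ?q (x + scale t v)) has_field_derivative c ^ k * DD v ?q x) (at 0)"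
    using has_dir_deriv_0[OF q] by (rule DERIV_cmult)
  moreover have "((\<lambda>t. c ^ length Y * ?q (scale c x + scale (c * t) v)) has_field_derivative
      c ^ length Y * (DD v ?q (scale c x) * c)) (at 0)"
  proof (intro DERIV_cmult DERIV_chain2[where f = "\<lambda>t. ?q (scale c x + scale t v)" and g = "\<lambda>t. c * t"])
    show "((\<lambda>t. ?q (scale c x + scale t v)) has_field_derivative DD v ?q (scale c x)) (at (c * 0))"
      using has_dir_deriv_0[OF q] by simp
  qed (auto intro!: derivative_eq_intros)
  \<comment> \<open>The induction hypothesis at \<open>x + scale t v\<close> identifies the two
    functions of \<open>t\<close> just differentiated, so their derivatives at 0 agree.\<close>
  moreover have "c ^ length Y * ?q (scale c x + scale (c * t) v) = c ^ k * ?q (x + scale t v)" for t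
    using Cons.IH[of "x + scale t v"] by (simp add: scale_right_distrib)
  ultimately have "c ^ length Y * (DD v ?q (scale c x) * c) = c ^ k * DD v ?q x"
    by (simp add: DERIV_unique)
  then show ?case by (simp add: dir_derivs_simps mult_ac)
qed

text \<open>The origin is fixed by scaling; with the factor 2 the value there is multiplied by two
  different powers of 2 on the two sides.\<close>

lemma dir_derivs_hom_at_0:
  assumes p: "p \<in> hom_poly_functions scale k" and Y: "length Y \<noteq> k"
  shows "dir_derivs scale Y p 0 = 0"
proof -
  have "(2::complex) ^ length Y \<noteq> 2 ^ k"
  proof
    assume "(2::complex) ^ length Y = 2 ^ k"
    then have "of_nat (2 ^ length Y) = (of_nat (2 ^ k) :: complex)" by simp
    then have "(2::nat) ^ length Y = 2 ^ k" by (simp only: of_nat_eq_iff)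
    with Y show False by simp
  qed
  moreover have "2 ^ length Y * dir_derivs scale Y p 0 = 2 ^ k * dir_derivs scale Y p 0"
    using dir_derivs_hom_scale[of p 2 k Y 0] p hom_poly_scale[OF p] hom_poly_functions_subset by auto
  ultimately show ?thesis by auto
qed

section \<open>Relative bases, deletion and contraction\<close>

text \<open>Instead of passing to the quotient by the already contracted vectors \<open>W\<close>, everything
  is relative to \<open>W\<close>.\<close>

definition rel_basis :: "(nat \<Rightarrow> 'v) \<Rightarrow> nat \<Rightarrow> 'v set \<Rightarrow> nat set \<Rightarrow> bool" where
  "rel_basis a m W I \<longleftrightarrow> I \<subseteq> {..<m} \<and> span (W \<union> a ` I) = UNIV \<and>
     (\<forall>i\<in>I. a i \<notin> span (W \<union> a ` {l \<in> I. i < l}))"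

text \<open>The condition on \<open>span W\<close> excludes the vectors that become zero in the
  quotient; it is not implied by the other one when no \<open>j\<close> in \<open>I\<close>
  satisfies \<open>i \<le> j\<close>. The set is not bounded by \<open>m\<close>, because
  \<open>D_at a m\<close> sees only the indices below \<open>m\<close>.\<close>

definition unbroken :: "(nat \<Rightarrow> 'v) \<Rightarrow> 'v set \<Rightarrow> nat set \<Rightarrow> nat set" where
  "unbroken a W I = {i. a i \<notin> span W \<and>
     (\<forall>j\<in>I. i \<le> j \<longrightarrow> a i \<notin> span (W \<union> a ` {l \<in> I. j \<le> l}))}"

definition D_at :: "(nat \<Rightarrow> 'v) \<Rightarrow> nat \<Rightarrow> nat set \<Rightarrow> ('v \<Rightarrow> complex) \<Rightarrow> 'v \<Rightarrow> complex" where
  "D_at a m Y = dir_derivs scale (map a (filter (\<lambda>i. i \<in> Y) [0..<m]))"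

lemma D_at_Suc: "D_at a (Suc m) Y p = D_at a m Y (if m \<in> Y then DD (a m) p else p)"
  by (simp add: D_at_def dir_derivs_simps)

lemma D_at_cong: "(\<And>i. i < m \<Longrightarrow> i \<in> Y \<longleftrightarrow> i \<in> Z) \<Longrightarrow> D_at a m Y = D_at a m Z"
  unfolding D_at_def
  by (intro arg_cong[where f = "dir_derivs scale"] arg_cong[where f = "map a"] filter_cong) auto

lemma rel_basis_Suc_delete:
  "rel_basis a m W I \<Longrightarrow> rel_basis a (Suc m) W I"
  by (auto simp: rel_basis_def)

text \<open>As \<open>m\<close> is the largest index, it belongs to the tail after every other
  index, where \<open>a m\<close> acts as a further element of \<open>W\<close>.\<close>

lemma rel_basis_Suc_contract:
  assumes I: "rel_basis a m (insert (a m) W) I" and a: "a m \<notin> span W"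
  shows "rel_basis a (Suc m) W (insert m I)"
  unfolding rel_basis_def
proof (intro conjI ballI)
  show "insert m I \<subseteq> {..<Suc m}" using I by (auto simp: rel_basis_def)
  show "span (W \<union> a ` insert m I) = UNIV" using I by (simp add: rel_basis_def)
  fix i assume i: "i \<in> insert m I"
  show "a i \<notin> span (W \<union> a ` {l \<in> insert m I. i < l})"
  proof (cases "i = m")
    case True
    have "{l \<in> insert m I. i < l} = {}" using I True by (auto simp: rel_basis_def)
    then show ?thesis using a by (simp only: True image_empty Un_empty_right not_False_eq_True)
  next
    case False
    then have "{l \<in> insert m I. i < l} = insert m {l \<in> I. i < l}" "i \<in> I"
      using I i by (auto simp: rel_basis_def)
    then show ?thesis using I by (simp add: rel_basis_def)
  qed
qed

text \<open>The tails starting in \<open>I\<close> contain \<open>m\<close>, and \<open>a m\<close>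
  moves over to \<open>W\<close>. The tail \<open>{m}\<close> gives exactly the condition on the
  enlarged span.\<close>

lemma unbroken_contract:
  assumes I: "I \<subseteq> {..<m}" and i: "i < m"
  shows "i \<in> unbroken a W (insert m I) \<longleftrightarrow> i \<in> unbroken a (insert (a m) W) I"
proof -
  have *: "W \<union> a ` {l \<in> insert m I. j \<le> l} = insert (a m) W \<union> a ` {l \<in> I. j \<le> l}" if "j \<in> I" for j
    using that I by auto
  have "{l \<in> insert m I. m \<le> l} = {m}" using I by auto
  then have m: "W \<union> a ` {l \<in> insert m I. m \<le> l} = insert (a m) W" by auto
  have "i \<in> unbroken a W (insert m I) \<longleftrightarrow> a i \<notin> span W \<and>
      a i \<notin> span (W \<union> a ` {l \<in> insert m I. m \<le> l}) \<and>
      (\<forall>j\<in>I. i \<le> j \<longrightarrow> a i \<notin> span (W \<union> a ` {l \<in> insert m I. j \<le> l}))"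
    using i unfolding unbroken_def mem_Collect_eq ball_simps(7) by simp
  also have "\<dots> \<longleftrightarrow> a i \<notin> span W \<and> a i \<notin> span (insert (a m) W) \<and>
      (\<forall>j\<in>I. i \<le> j \<longrightarrow> a i \<notin> span (insert (a m) W \<union> a ` {l \<in> I. j \<le> l}))"
    by (simp only: m * cong: ball_cong)
  also have "\<dots> \<longleftrightarrow> i \<in> unbroken a (insert (a m) W) I"
    using span_mono[of W "insert (a m) W"] unfolding unbroken_def mem_Collect_eq by blast
  finally show ?thesis .
qed

text \<open>The second hypothesis makes \<open>p\<close> a function on the quotient by
  \<open>span W\<close>, the third puts it into the space D of the images of the first
  \<open>m\<close> vectors there, and the fourth says that the functionals of all bases vanish on
  it. The induction removes the last vector by deletion and contraction.\<close>

lemma D_space_separation: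
  assumes "p \<in> P" "\<And>w. w \<in> W \<Longrightarrow> DD w p = 0"
    and "\<And>Y. span (W \<union> a ` ({..<m} - Y)) \<noteq> UNIV \<Longrightarrow> D_at a m Y p = 0"
    and "\<And>I. rel_basis a m W I \<Longrightarrow> D_at a m (unbroken a W I) p 0 = 0"
  shows "p = 0"
  using assms
proof (induction m arbitrary: W p)
  case 0
  show ?case
  \<comment> \<open>If \<open>W\<close> spans, \<open>p\<close> is constant and the functional of
    the empty basis is evaluation at 0. Otherwise the empty list is a cocircuit and says
    \<open>p = 0\<close>.\<close>
  proof (cases "span W = UNIV")
    case True
    have "DD v p = 0" for v
      using dir_deriv_span_eq_0[OF 0(1) 0(2)] True by blast
    then have "p = (\<lambda>_. p 0)" by (rule poly_eq_const[OF 0(1)])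
    moreover have "p 0 = 0"
      using 0(4)[of "{}"] True by (simp add: rel_basis_def D_at_def dir_derivs_simps)
    ultimately show "p = 0" by (simp add: zero_fun_def)
  next
    case False
    then show "p = 0" using 0(3)[of "{}"] by (simp add: D_at_def dir_derivs_simps zero_fun_def)
  qed
next
  case (Suc m)
  \<comment> \<open>A cocircuit that leaves \<open>a m\<close> in its complement imposes a condition
    without differentiation along \<open>a m\<close>.\<close>
  have drop: "D_at a m Y p = 0" if "span (W \<union> a ` ({..<Suc m} - (Y - {m}))) \<noteq> UNIV" for Y
  proof -
    have "D_at a (Suc m) (Y - {m}) p = 0" by (rule Suc.prems(3)[OF that])
    moreover have "D_at a m (Y - {m}) = D_at a m Y" by (rule D_at_cong) auto
    ultimately show ?thesis by (simp add: D_at_Suc)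
  qed
  have lessThan_Suc_minus: "W \<union> a ` ({..<Suc m} - (Y - {m})) = insert (a m) (W \<union> a ` ({..<m} - Y))" for Y
    by (auto simp: less_Suc_eq)
  show ?case
  proof (cases "a m \<in> span W")
    case True
    show "p = 0"
    proof (rule Suc.IH[of p W])
      fix Y assume Y: "span (W \<union> a ` ({..<m} - Y)) \<noteq> UNIV"
      have "a m \<in> span (W \<union> a ` ({..<m} - Y))" using True span_mono[of W] by blast
      then show "D_at a m Y p = 0"
        using Y drop[of Y] by (simp add: lessThan_Suc_minus span_redundant)
    next
      fix I assume I: "rel_basis a m W I"
      have "m \<notin> unbroken a W I" using True by (simp add: unbroken_def)
      then show "D_at a m (unbroken a W I) p 0 = 0"
        using Suc.prems(4)[OF rel_basis_Suc_delete[OF I]] by (simp add: D_at_Suc)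
    qed (use Suc.prems in auto)
  next
    case False
    \<comment> \<open>Deletion: adding \<open>m\<close> to a cocircuit of the first \<open>m\<close>
      vectors keeps its complement, and \<open>m\<close> is unbroken for every basis avoiding it.
      All conditions thus pass to the derivative along \<open>a m\<close>.\<close>
    have "DD (a m) p = 0"
    proof (rule Suc.IH[of _ W])
      show "DD (a m) p \<in> P" using Suc.prems(1) by (rule dir_deriv_poly)
      show "DD w (DD (a m) p) = 0" if "w \<in> W" for w
      proof -
        have "DD w p = 0" by (rule Suc.prems(2)[OF that])
        then show ?thesis by (simp add: dir_deriv_commute[OF Suc.prems(1), of w])
      qed
      show "D_at a m Y (DD (a m) p) = 0" if "span (W \<union> a ` ({..<m} - Y)) \<noteq> UNIV" for Y
      proof -
        have "{..<Suc m} - insert m Y = {..<m} - Y" by auto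
        then have "D_at a (Suc m) (insert m Y) p = 0" using that by (intro Suc.prems(3)) simp
        moreover have "D_at a m (insert m Y) = D_at a m Y" by (rule D_at_cong) auto
        ultimately show ?thesis by (simp add: D_at_Suc)
      qed
      show "D_at a m (unbroken a W I) (DD (a m) p) 0 = 0" if I: "rel_basis a m W I" for I
      proof -
        have "m \<in> unbroken a W I" using False I by (auto simp: unbroken_def rel_basis_def)
        then show ?thesis
          using Suc.prems(4)[OF rel_basis_Suc_delete[OF I]] by (simp add: D_at_Suc)
      qed
    qed
    \<comment> \<open>Contraction: \<open>p\<close> is now constant along \<open>a m\<close>, which
      joins \<open>W\<close>. In a basis containing \<open>m\<close> this vector breaks the basis
      itself, so the functional has no derivative along it.\<close>
    show "p = 0"
    proof (rule Suc.IH[of _ "insert (a m) W"])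
      show "DD w p = 0" if "w \<in> insert (a m) W" for w
        using that Suc.prems(2) \<open>DD (a m) p = 0\<close> by auto
      show "D_at a m Y p = 0" if "span (insert (a m) W \<union> a ` ({..<m} - Y)) \<noteq> UNIV" for Y
        using that by (intro drop) (simp add: lessThan_Suc_minus)
      show "D_at a m (unbroken a (insert (a m) W) I) p 0 = 0"
        if I: "rel_basis a m (insert (a m) W) I" for I
      proof -
        have "m \<notin> unbroken a W (insert m I)"
          using I by (auto simp: unbroken_def intro!: span_base)
        moreover have "D_at a m (unbroken a W (insert m I)) = D_at a m (unbroken a (insert (a m) W) I)"
          using I by (intro D_at_cong unbroken_contract) (auto simp: rel_basis_def)
        ultimately show ?thesis
          using Suc.prems(4)[OF rel_basis_Suc_contract[OF I False]] by (simp add: D_at_Suc)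
      qed
    qed (fact Suc.prems(1))
  qed
qed

section \<open>Homogeneous components of exponential sums\<close>

text \<open>The homogeneous component of degree \<open>k\<close> of \<open>\<Sum>b\<in>B. c b * exp (f b)\<close>.\<close>

definition power_comb ::
    "'b set \<Rightarrow> ('b \<Rightarrow> 'v \<Rightarrow> complex) \<Rightarrow> nat \<Rightarrow> ('b \<Rightarrow> complex) \<Rightarrow> 'v \<Rightarrow> complex" where
  "power_comb B f k c = (\<lambda>x. \<Sum>b\<in>B. c b * f b x ^ k / fact k)"

lemma power_comb_hom:
  assumes "\<And>b. b \<in> B \<Longrightarrow> f b \<in> dual_space scale"
  shows "power_comb B f k c \<in> hom_poly_functions scale k"
proof -
  have "power_comb B f k c = (\<Sum>b\<in>B. fscale (c b / fact k) (\<lambda>x. \<Prod>i<k. f b x))"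
  proof
    fix x
    have "(\<Sum>b\<in>B'. fscale (c b / fact k) (\<lambda>x. \<Prod>i<k. f b x)) x =
        (\<Sum>b\<in>B'. c b * f b x ^ k / fact k)" for B'
      by (induction B' rule: infinite_finite_induct) (auto simp: fscale_def)
    then show "power_comb B f k c x = (\<Sum>b\<in>B. fscale (c b / fact k) (\<lambda>x. \<Prod>i<k. f b x)) x"
      by (simp add: power_comb_def)
  qed
  also have "\<dots> \<in> hom_poly_functions scale k"
    unfolding hom_poly_functions_def
    by (intro fs.span_sum fs.span_scale fs.span_base) (auto intro!: assms exI[of _ "\<lambda>_. f _"])
  finally show ?thesis .
qed

lemma dir_deriv_power_comb_0: "DD v (power_comb B f 0 c) = 0"
  unfolding power_comb_def by (simp add: dir_deriv_const)

text \<open>Degree by degree, this is the rule that D_v multiplies exp(f) by f(v).\<close>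

lemma dir_deriv_power_comb_Suc:
  assumes f: "\<And>b. b \<in> B \<Longrightarrow> f b \<in> dual_space scale"
  shows "DD v (power_comb B f (Suc k) c) = power_comb B f k (\<lambda>b. c b * f b v)"
proof (intro dir_deriv_eqI)
  fix x
  have *: "power_comb B f (Suc k) c (x + scale t v) =
      (\<Sum>b\<in>B. c b * (f b x + t * f b v) ^ Suc k / fact (Suc k))" for t
    using f by (simp add: power_comb_def dual_add dual_scale)
  have "((\<lambda>t. \<Sum>b\<in>B. c b * (f b x + t * f b v) ^ Suc k / fact (Suc k)) has_field_derivative
      (\<Sum>b\<in>B. c b * (of_nat (Suc k) * (f b x) ^ k * f b v) / fact (Suc k))) (at 0)"
    by (intro DERIV_sum) (auto intro!: derivative_eq_intros simp del: power_Suc fact_Suc)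
  also have "(\<Sum>b\<in>B. c b * (of_nat (Suc k) * (f b x) ^ k * f b v) / fact (Suc k)) =
      power_comb B f k (\<lambda>b. c b * f b v) x"
    unfolding power_comb_def by (intro sum.cong refl) (simp add: field_simps del: of_nat_Suc)
  finally show "((\<lambda>t. power_comb B f (Suc k) c (x + scale t v)) has_field_derivative
      power_comb B f k (\<lambda>b. c b * f b v) x) (at 0)"
    by (simp only: *)
qed

text \<open>The operator D_v - l acts on an exponential sum by multiplying the coefficients by
  \<open>f b v - l\<close>; this is its effect in degree \<open>k\<close>.\<close>

lemma power_comb_diff:
  "power_comb B f k (\<lambda>b. c b * (f b v - l)) =
     power_comb B f k (\<lambda>b. c b * f b v) - fscale l (power_comb B f k c)"
  by (simp add: power_comb_def fscale_def fun_eq_iff sum_distrib_left sum_subtractf[symmetric] field_simps)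

text \<open>If all components below degree k vanish, then D_v of the component of degree k is the
  component of degree k - 1 of (D_v - l) applied to the whole sum, which again has nothing below.
  After all factors every coefficient is zero.\<close>

lemma power_comb_lowest_killed:
  assumes f: "\<And>b. b \<in> B \<Longrightarrow> f b \<in> dual_space scale"
    and low: "\<And>j. j < k \<Longrightarrow> power_comb B f j c = 0"
    and prod: "\<And>b. b \<in> B \<Longrightarrow> c b * (\<Prod>i\<leftarrow>is. f b (a i) - l i) = 0"
  shows "dir_derivs scale (map a is) (power_comb B f k c) = 0"
  using low prod
proof (induction "is" arbitrary: c k rule: rev_induct)
  case Nil
  then show ?case
    by (simp add: dir_derivs_simps power_comb_def fun_eq_iff)
next
  case (snoc i "is")
  show "dir_derivs scale (map a (is @ [i])) (power_comb B f k c) = 0"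
  proof (cases k)
    case 0
    then show ?thesis by (simp add: dir_derivs_simps dir_deriv_power_comb_0 dir_derivs_0)
  next
    case (Suc k')
    let ?c = "\<lambda>b. c b * (f b (a i) - l i)"
    \<comment> \<open>The new coefficients \<open>?c\<close> belong to the sum after applying D - l;
      its components start one degree lower.\<close>
    have eq: "power_comb B f j ?c = DD (a i) (power_comb B f (Suc j) c)" if "j < k" for j
    proof -
      have "power_comb B f j c = 0" by (rule snoc.prems(1)[OF that])
      then show ?thesis by (simp add: power_comb_diff dir_deriv_power_comb_Suc f)
    qed
    have "dir_derivs scale (map a is) (power_comb B f k' ?c) = 0"
    proof (rule snoc.IH)
      show "power_comb B f j ?c = 0" if "j < k'" for j
      proof -
        have "power_comb B f (Suc j) c = 0" using that Suc by (intro snoc.prems(1)) simp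
        with eq[of j] that Suc show ?thesis by simp
      qed
      show "?c b * (\<Prod>i\<leftarrow>is. f b (a i) - l i) = 0" if "b \<in> B" for b
        using snoc.prems(2)[OF that] by (auto simp: prod_list.append)
    qed
    with eq[of k'] Suc show ?thesis by (simp add: dir_derivs_simps)
  qed
qed

text \<open>Applying the operators D - l to an exponential sum with all components zero leaves all
  components zero. Working degreewise avoids any question of convergence.\<close>

lemma power_comb_mult_prod_eq_0:
  assumes f: "\<And>b. b \<in> B \<Longrightarrow> f b \<in> dual_space scale"
    and c: "\<And>k. power_comb B f k c = 0" and I: "finite I"
  shows "power_comb B f k (\<lambda>b. c b * (\<Prod>i\<in>I. f b (a i) - l i)) = 0"
  using I
proof (induction I arbitrary: k rule: finite_induct)
  case empty
  show ?case using c by simp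
next
  case (insert i I)
  let ?c = "\<lambda>b. c b * (\<Prod>i\<in>I. f b (a i) - l i)"
  have IH: "power_comb B f k ?c = 0" for k by (rule insert.IH)
  have "power_comb B f k (\<lambda>b. ?c b * (f b (a i) - l i)) =
      power_comb B f k (\<lambda>b. ?c b * f b (a i))"
    using power_comb_diff[of B f k ?c "a i" "l i"] by (simp only: IH) simp
  also have "\<dots> = DD (a i) (power_comb B f (Suc k) ?c)" by (simp only: dir_deriv_power_comb_Suc f)
  also have "\<dots> = 0" by (simp only: IH dir_deriv_0)
  also have "(\<lambda>b. ?c b * (f b (a i) - l i)) = (\<lambda>b. c b * (\<Prod>i\<in>insert i I. f b (a i) - l i))"
    using insert.hyps by (simp add: mult_ac)
  finally show "power_comb B f k (\<lambda>b. c b * (\<Prod>i\<in>insert i I. f b (a i) - l i)) = 0" .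
qed

section \<open>Triangular independence and generic functionals\<close>

text \<open>Adding the indices in decreasing order, each new vector lies outside the span of those
  already present.\<close>

lemma inj_on_independent_triangular:
  fixes I :: "'i::linorder set"
  assumes "finite I" "\<And>i. i \<in> I \<Longrightarrow> a i \<notin> span (a ` {l \<in> I. i < l})"
  shows "inj_on a I \<and> independent (a ` I)"
  using assms
proof (induction I rule: finite_linorder_min_induct)
  case (insert b A)
  have "a i \<notin> span (a ` {l \<in> A. i < l})" if "i \<in> A" for i
  proof -
    have "{l \<in> insert b A. i < l} = {l \<in> A. i < l}" using insert.hyps that by auto
    then show ?thesis using insert.prems[of i] that by simp
  qed
  then have IH: "inj_on a A" "independent (a ` A)" using insert.IH by auto
  have "{l \<in> insert b A. b < l} = A" using insert.hyps by auto
  then have b: "a b \<notin> span (a ` A)" using insert.prems[of b] by simp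
  then have "a b \<notin> a ` A" using span_base by blast
  with IH b insert.hyps show ?case by (auto simp: independent_insert)
qed (simp add: independent_empty)

text \<open>Taking \<open>l i = t ^ i\<close>, each condition \<open>f b (a i) \<noteq> l i\<close> excludes only the roots \<open>t\<close>
  of a polynomial whose \<open>i\<close>-th coefficient is \<open>1\<close>.\<close>

lemma generic_points:
  fixes a :: "nat \<Rightarrow> 'v"
  assumes EB: "finite EB"
    and bases: "\<And>b. b \<in> EB \<Longrightarrow> finite b \<and> inj_on a b \<and> independent (a ` b) \<and> span (a ` b) = UNIV"
  shows "\<exists>l f. \<forall>b\<in>EB. f b \<in> dual_space scale \<and> (\<forall>i<N. f b (a i) = l i \<longleftrightarrow> i \<in> b)"
proof -
  define R where "R b v j = representation (a ` b) v (a j)" for b v j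
  \<comment> \<open>At \<open>t\<close>, this polynomial is the difference between
    \<open>t ^ i\<close> and the value at \<open>a i\<close> of the functional that takes the values
    \<open>t ^ j\<close> on the basis \<open>b\<close>.\<close>
  define q where "q b i = monom 1 i - (\<Sum>j\<in>b. monom (R b (a i) j) j)" for b i
  define Q where "Q = (\<Prod>b\<in>EB. \<Prod>i\<in>{..<N} - b. q b i)"
  have "q b i \<noteq> 0" if "b \<in> EB" "i \<notin> b" for b i
  proof -
    have "coeff (q b i) i = 1 - (\<Sum>j\<in>b. if j = i then R b (a i) j else 0)"
      by (simp add: q_def coeff_sum)
    also have "(\<Sum>j\<in>b. if j = i then R b (a i) j else 0) = 0"
      using that by (intro sum.neutral) auto
    finally show ?thesis by auto
  qed
  then have "Q \<noteq> 0" using EB by (simp add: Q_def)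
  then have "finite {t. poly Q t = 0}" by (rule poly_roots_finite)
  then obtain t where t: "poly Q t \<noteq> 0"
    using ex_new_if_finite[OF infinite_UNIV_char_0] by blast
  define f where "f b v = (\<Sum>j\<in>b. R b v j * t ^ j)" for b v
  have "f b \<in> dual_space scale" if "b \<in> EB" for b
    using bases[OF that] vector_space_axioms vector_space_over_itself.vector_space_axioms
    by (auto simp: dual_space_def Vector_Spaces.linear_iff f_def R_def representation_add
        representation_scale sum.distrib sum_distrib_left algebra_simps)
  moreover have "f b (a i) = t ^ i" if "b \<in> EB" "i \<in> b" for b i
  proof -
    have "R b (a i) j = (if j = i then 1 else 0)" if "j \<in> b" for j
      using bases[OF \<open>b \<in> EB\<close>] that \<open>i \<in> b\<close>
      by (auto simp: R_def representation_basis inj_on_eq_iff)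
    then have "f b (a i) = (\<Sum>j\<in>b. if j = i then t ^ j else 0)"
      unfolding f_def by (intro sum.cong) auto
    then show ?thesis using bases[OF that(1)] that by simp
  qed
  moreover have "f b (a i) \<noteq> t ^ i" if "b \<in> EB" "i \<notin> b" "i < N" for b i
  proof -
    have "poly (q b i) t = t ^ i - f b (a i)"
      by (simp add: q_def f_def poly_sum poly_monom)
    moreover have "poly (q b i) t \<noteq> 0"
      using t that EB by (simp add: Q_def poly_prod)
    ultimately show ?thesis by auto
  qed
  ultimately show ?thesis by (intro exI[of _ "\<lambda>i. t ^ i"] exI[of _ f]) blast
qed

section \<open>Sublists of \<open>X\<close> and the upper bound\<close>

lemma set_nths_subset_image: "I \<subseteq> {..<length X} \<Longrightarrow> set (nths X I) = (!) X ` I"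
  by (auto simp: set_nths)

lemma extracted_bases_iff:
  "I \<in> extracted_bases scale X \<longleftrightarrow>
     I \<subseteq> {..<length X} \<and> inj_on ((!) X) I \<and> independent ((!) X ` I) \<and> span ((!) X ` I) = UNIV"
proof (cases "I \<subseteq> {..<length X}")
  case True
  then have "{i. i < length X \<and> i \<in> I} = I" by auto
  then have "distinct (nths X I) \<longleftrightarrow> inj_on ((!) X) I"
    by (simp add: nths_eq_map_filter distinct_map)
  with True show ?thesis by (simp add: extracted_bases_def set_nths_subset_image)
qed (simp add: extracted_bases_def)

lemma dir_derivs_nths: "dir_derivs scale (nths X I) = D_at ((!) X) (length X) I"
  by (simp add: nths_eq_map_filter D_at_def)

lemma rel_basis_extracted:
  assumes "rel_basis ((!) X) (length X) {} I"
  shows "I \<in> extracted_bases scale X"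
proof -
  have I: "I \<subseteq> {..<length X}" using assms by (simp add: rel_basis_def)
  then have "finite I" using finite_subset by blast
  then have "inj_on ((!) X) I \<and> independent ((!) X ` I)"
    using assms by (intro inj_on_independent_triangular) (auto simp: rel_basis_def)
  with assms I show ?thesis by (auto simp: extracted_bases_iff rel_basis_def)
qed

text \<open>For empty \<open>W\<close> the condition on \<open>span W\<close> only says that the
  vector is nonzero; the rest is the negation of breaking.\<close>

lemma unbroken_eq:
  assumes X: "0 \<notin> set X" and I: "I \<subseteq> {..<length X}"
  shows "{..<length X} \<inter> unbroken ((!) X) {} I = {..<length X} - breaking scale X I"
proof -
  have "set (nths X {l \<in> I. j \<le> l}) = (!) X ` {l \<in> I. j \<le> l}" for j
    using I by (intro set_nths_subset_image) auto
  moreover have "X ! i \<noteq> 0" if "i < length X" for i using X that nth_mem by metis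
  ultimately show ?thesis by (auto simp: unbroken_def breaking_def)
qed

lemma D_space_subspace: "fs.subspace (D_space scale X)"
  by (auto simp: fs.subspace_def D_space_def poly_0 poly_fscale poly_functions.add
      dir_derivs_0 dir_derivs_add dir_derivs_fscale)

lemma D_hom_subspace: "fs.subspace (D_hom scale X k)"
  unfolding D_hom_def by (intro fs.subspace_inter D_space_subspace hom_poly_subspace)

abbreviation "deg X b \<equiv> length X - card (breaking scale X b)"

text \<open>This is the order of the differential operator attached to \<open>I\<close>. Breaking
  indices lie below \<open>length X\<close>, so the subtraction in \<open>deg\<close> is not
  truncated.\<close>

lemma card_unbroken:
  assumes X: "0 \<notin> set X" and I: "I \<subseteq> {..<length X}"
  shows "length (filter (\<lambda>i. i \<in> unbroken ((!) X) {} I) [0..<length X]) = deg X I"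
proof -
  have "length (filter (\<lambda>i. i \<in> unbroken ((!) X) {} I) [0..<length X]) =
      card (set (filter (\<lambda>i. i \<in> unbroken ((!) X) {} I) [0..<length X]))"
    by (intro distinct_card[symmetric]) simp
  also have "set (filter (\<lambda>i. i \<in> unbroken ((!) X) {} I) [0..<length X]) =
      {..<length X} \<inter> unbroken ((!) X) {} I" by auto
  also have "\<dots> = {..<length X} - breaking scale X I" by (rule unbroken_eq[OF X I])
  also have "card \<dots> = deg X I"
    by (subst card_Diff_subset) (auto simp: breaking_def intro: finite_subset[of _ "{..<length X}"])
  finally show ?thesis .
qed

lemma finite_extracted_bases: "finite (extracted_bases scale X)"
  by (rule finite_subset[of _ "Pow {..<length X}"]) (auto simp: extracted_bases_def)

text \<open>The functionals of all bases separate the points of D(X), and those of order different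
  from \<open>k\<close> vanish on forms of degree \<open>k\<close>. Hence those of order
  \<open>k\<close> separate this component.\<close>

lemma D_hom_independent_bound:
  assumes X: "0 \<notin> set X" and B: "B \<subseteq> D_hom scale X k" "fs.independent B"
  shows "finite B \<and> card B \<le> card {b \<in> extracted_bases scale X. deg X b = k}"
proof (rule fs.independent_card_le_separating[OF D_hom_subspace])
  let ?\<phi> = "\<lambda>b p. D_at ((!) X) (length X) (unbroken ((!) X) {} b) p 0"
  have poly: "p \<in> P" if "p \<in> D_hom scale X k" for p
    using that by (simp add: D_hom_def D_space_def)
  show "?\<phi> b (p + q) = ?\<phi> b p + ?\<phi> b q" if "p \<in> D_hom scale X k" "q \<in> D_hom scale X k" for b p q
    using that by (simp add: D_at_def dir_derivs_add poly)
  show "?\<phi> b (fscale c p) = c * ?\<phi> b p" if "p \<in> D_hom scale X k" for b c p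
    using dir_derivs_fscale[OF poly[OF that]] by (simp add: D_at_def fscale_def)
  show "p = 0" if p: "p \<in> D_hom scale X k"
    and 0: "\<And>b. b \<in> {b \<in> extracted_bases scale X. deg X b = k} \<Longrightarrow> ?\<phi> b p = 0" for p
  proof (rule D_space_separation[where W = "{}" and a = "(!) X" and m = "length X"])
    fix Y assume Y: "span ({} \<union> (!) X ` ({..<length X} - Y)) \<noteq> UNIV"
    have "{..<length X} - Y \<inter> {..<length X} = {..<length X} - Y" by auto
    then have "Y \<inter> {..<length X} \<in> cocircuits scale X"
      using Y by (simp add: cocircuits_def set_nths_subset_image)
    then have "D_at ((!) X) (length X) (Y \<inter> {..<length X}) p = 0"
      using p by (simp add: D_hom_def D_space_def dir_derivs_nths)
    moreover have "D_at ((!) X) (length X) (Y \<inter> {..<length X}) = D_at ((!) X) (length X) Y"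
      by (rule D_at_cong) auto
    ultimately show "D_at ((!) X) (length X) Y p = 0" by simp
  next
    fix I assume "rel_basis ((!) X) (length X) {} I"
    then have I: "I \<in> extracted_bases scale X" by (rule rel_basis_extracted)
    show "?\<phi> I p = 0"
    proof (cases "deg X I = k")
      case False
      then have "length (filter (\<lambda>i. i \<in> unbroken ((!) X) {} I) [0..<length X]) \<noteq> k"
        using I card_unbroken[OF X, of I] by (simp add: extracted_bases_iff)
      then show ?thesis
        using p unfolding D_at_def by (intro dir_derivs_hom_at_0) (auto simp: D_hom_def)
    qed (use 0 I in blast)
  qed (use poly[OF p] in auto)
qed (use finite_extracted_bases B in auto)

section \<open>Exponential sums attached to the bases\<close>

lemma card_extracted_basis:
  assumes "b \<in> extracted_bases scale X"
  shows "card b = dim (UNIV :: 'v set)"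
  using assms dim_unique[of "(!) X ` b" UNIV "card b"]
  by (auto simp: extracted_bases_iff card_image)

lemma power_comb_eq_sum:
  "power_comb B f k c = (\<Sum>b\<in>B. fscale (c b) (\<lambda>x. f b x ^ k / fact k))"
proof
  fix x
  show "power_comb B f k c x = (\<Sum>b\<in>B. fscale (c b) (\<lambda>x. f b x ^ k / fact k)) x"
    unfolding power_comb_def
    by (induction B rule: infinite_finite_induct) (auto simp: fscale_def)
qed

text \<open>A cocircuit meets every basis, since its complement does not span. At a common index the
  factor \<open>f b (X ! i) - l i\<close> is zero, so the product over the cocircuit annihilates
  every exponential.\<close>

lemma power_comb_lowest_D_hom:
  assumes f: "\<And>b. b \<in> extracted_bases scale X \<Longrightarrow> f b \<in> dual_space scale"
    and l: "\<And>b i. b \<in> extracted_bases scale X \<Longrightarrow> i \<in> b \<Longrightarrow> f b (X ! i) = l i"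
    and low: "\<And>j. j < k \<Longrightarrow> power_comb (extracted_bases scale X) f j c = 0"
  shows "power_comb (extracted_bases scale X) f k c \<in> D_hom scale X k"
proof -
  let ?EB = "extracted_bases scale X"
  have hom: "power_comb ?EB f k c \<in> hom_poly_functions scale k"
    by (intro power_comb_hom f)
  have "dir_derivs scale (nths X Y) (power_comb ?EB f k c) = 0" if Y: "Y \<in> cocircuits scale X" for Y
    unfolding nths_eq_map_filter
  proof (rule power_comb_lowest_killed[OF f low])
    fix b assume b: "b \<in> ?EB"
    obtain i where "i \<in> b" "i \<in> Y"
    proof (rule ccontr)
      assume "\<not> thesis"
      then have "b \<subseteq> {..<length X} - Y" using b that by (auto simp: extracted_bases_iff)
      then have "span ((!) X ` b) \<subseteq> span ((!) X ` ({..<length X} - Y))"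
        by (intro span_mono image_mono)
      then show False using Y b
        by (auto simp: cocircuits_def extracted_bases_iff set_nths_subset_image)
    qed
    moreover have "i < length X" using b \<open>i \<in> b\<close> by (auto simp: extracted_bases_iff)
    ultimately show "c b * (\<Prod>i\<leftarrow>filter (\<lambda>i. i \<in> Y) [0..<length X]. f b (X ! i) - l i) = 0"
      using l[OF b] by (force simp: prod_list_zero_iff)
  qed
  with hom show ?thesis using hom_poly_functions_subset by (auto simp: D_hom_def D_space_def)
qed

text \<open>This is the independence of the exponentials: the product of D - l over the indices
  outside \<open>b0\<close> annihilates every exponential except that of \<open>b0\<close>. Another
  basis has equally many elements, hence one outside \<open>b0\<close>, while genericity keeps the
  factors at \<open>b0\<close> nonzero.\<close>

lemma power_comb_coeff_eq_0:
  assumes f: "\<And>b. b \<in> extracted_bases scale X \<Longrightarrow> f b \<in> dual_space scale"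
    and l: "\<And>b i. b \<in> extracted_bases scale X \<Longrightarrow> i < length X \<Longrightarrow> f b (X ! i) = l i \<longleftrightarrow> i \<in> b"
    and c: "\<And>k. power_comb (extracted_bases scale X) f k c = 0"
    and b0: "b0 \<in> extracted_bases scale X"
  shows "c b0 = 0"
proof -
  let ?EB = "extracted_bases scale X"
  let ?g = "\<lambda>b. \<Prod>i\<in>{..<length X} - b0. f b (X ! i) - l i"
  have "?g b = 0" if b: "b \<in> ?EB" "b \<noteq> b0" for b
  proof -
    have "b \<subseteq> {..<length X}" "b0 \<subseteq> {..<length X}" using b b0 by (auto simp: extracted_bases_iff)
    moreover have "\<not> b \<subseteq> b0"
      using b b0 calculation card_extracted_basis[OF b(1)] card_extracted_basis[OF b0]
      by (metis card_subset_eq finite_lessThan finite_subset)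
    ultimately obtain i where "i \<in> b" "i \<in> {..<length X} - b0" by blast
    then show ?thesis using l[OF b(1)] by (intro prod_zero) auto
  qed
  then have "(\<Sum>b\<in>?EB. c b * ?g b) = (\<Sum>b\<in>{b0}. c b * ?g b)"
    using b0 finite_extracted_bases by (intro sum.mono_neutral_right) auto
  \<comment> \<open>The component of degree 0 is the plain sum of the coefficients.\<close>
  moreover have "power_comb ?EB f 0 (\<lambda>b. c b * ?g b) 0 = 0"
    using power_comb_mult_prod_eq_0[OF f c, of "{..<length X} - b0" 0 "(!) X" l] by simp
  ultimately have "c b0 * ?g b0 = 0" by (simp add: power_comb_def)
  moreover have "?g b0 \<noteq> 0" using l[OF b0] by (auto simp: prod_zero_iff)
  ultimately show ?thesis by simp
qed

section \<open>Comparison of the two bounds\<close>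

text \<open>Each dimension is at most the number \<open>h k\<close> of bases of degree
  \<open>k\<close>, and the dimensions add up to at least the sum of the \<open>h k\<close>; both
  sums are finite, so all the inequalities are equalities.\<close>

lemma hilbert_series_eq:
  assumes X: "0 \<notin> set X"
  shows "hilbert_series scale X = (\<Sum>b\<in>extracted_bases scale X. fps_X ^ deg X b)"
proof -
  let ?EB = "extracted_bases scale X" and ?D = "D_hom scale X" and ?N = "length X"
  define h where "h k = card {b \<in> ?EB. deg X b = k}" for k
  have "\<exists>B. B \<subseteq> ?D k \<and> fs.independent B \<and> ?D k \<subseteq> fs.span B \<and> card B = fs.dim (?D k)" for k
    by (rule fs.basis_exists[of "?D k"]) blast
  then obtain B where B: "\<And>k. B k \<subseteq> ?D k" "\<And>k. fs.independent (B k)"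
    "\<And>k. ?D k \<subseteq> fs.span (B k)" "\<And>k. card (B k) = fs.dim (?D k)"
    by metis
  have fin: "finite (B k)" and le: "card (B k) \<le> h k" for k
    using D_hom_independent_bound[OF X B(1,2)] by (auto simp: h_def)
  have h0: "h k = 0" if "k > ?N" for k
    using that by (auto simp: h_def card_eq_0_iff)
  have B0: "B k = {}" if "k > ?N" for k
    using le[of k] h0[OF that] fin[of k] by simp
  have "card ?EB \<le> card (SIGMA k:{..?N}. B k)"
  proof (rule ccontr)
    assume "\<not> ?thesis"
    then have less: "card (SIGMA k:{..?N}. B k) < card ?EB" by simp
    have "\<exists>l f. \<forall>b\<in>?EB. f b \<in> dual_space scale \<and> (\<forall>i<?N. f b (X ! i) = l i \<longleftrightarrow> i \<in> b)"
      by (rule generic_points[OF finite_extracted_bases])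
        (auto simp: extracted_bases_iff intro: finite_subset[of _ "{..<?N}"])
    then obtain l f where f: "\<And>b. b \<in> ?EB \<Longrightarrow> f b \<in> dual_space scale"
      and l: "\<And>b i. b \<in> ?EB \<Longrightarrow> i < ?N \<Longrightarrow> f b (X ! i) = l i \<longleftrightarrow> i \<in> b"
      by blast
    \<comment> \<open>A single power of \<open>f b\<close> need not lie in the component of D(X).
      Coordinates are therefore taken in an extension of \<open>B k\<close> to a basis of the whole
      function space, which makes them linear in the coefficients \<open>c\<close>.\<close>
    let ?R = "\<lambda>k. fs.representation (fs.extend_basis (B k))"
    have "finite (SIGMA k:{..?N}. B k)" using fin by auto
    from exists_nontrivial_solution[OF this finite_extracted_bases less,
        of "\<lambda>(k, v) b. ?R k (\<lambda>x. f b x ^ k / fact k) v"]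
    obtain c where c: "\<exists>b\<in>?EB. c b \<noteq> 0" and
      sol: "\<And>k v. k \<le> ?N \<Longrightarrow> v \<in> B k \<Longrightarrow> (\<Sum>b\<in>?EB. c b * ?R k (\<lambda>x. f b x ^ k / fact k) v) = 0"
      by auto
    \<comment> \<open>Once the lower components vanish, the one of degree \<open>k\<close> lies in
      the span of \<open>B k\<close>. Its coordinates there are zero by the choice of
      \<open>c\<close>; beyond degree \<open>?N\<close> the basis \<open>B k\<close> is
      empty.\<close>
    have "power_comb ?EB f k c = 0" for k
    proof (induction k rule: less_induct)
      case (less k)
      let ?L = "power_comb ?EB f k c"
      have ind: "fs.independent (fs.extend_basis (B k))"
        by (rule fs.independent_extend_basis[OF B(2)])
      have "?L \<in> ?D k"
      proof (rule power_comb_lowest_D_hom[OF f])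
        show "f b (X ! i) = l i" if "b \<in> ?EB" "i \<in> b" for b i
          using l[OF that(1)] that by (auto simp: extracted_bases_iff)
        show "power_comb ?EB f j c = 0" if "j < k" for j by (rule less.IH[OF that])
      qed
      then have L: "?L \<in> fs.span (B k)" using B(3) by blast
      have "fs.representation (B k) ?L v = 0" if v: "v \<in> B k" for v
      proof -
        have "fs.representation (B k) ?L v = ?R k ?L v"
          using fs.representation_extend[OF ind L fs.extend_basis_superset[OF B(2)]] by simp
        also have "\<dots> = (\<Sum>b\<in>?EB. c b * ?R k (\<lambda>x. f b x ^ k / fact k) v)"
          unfolding power_comb_eq_sum
          by (simp add: fs.representation_sum[OF ind] fs.representation_scale[OF ind]
              fs.span_extend_basis[OF B(2)])
        also have "\<dots> = 0" using sol[of k v] v B0[of k] by (cases "k \<le> ?N") auto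
        finally show ?thesis .
      qed
      then have "(\<Sum>v\<in>B k. fscale (fs.representation (B k) ?L v) v) = 0" by simp
      then show "?L = 0"
        using fs.sum_representation_eq[OF B(2) L fin subset_refl] by simp
    qed
    then have "c b = 0" if "b \<in> ?EB" for b
      using power_comb_coeff_eq_0[OF f l _ that] by blast
    with c show False by blast
  qed
  also have "\<dots> = (\<Sum>k\<le>?N. card (B k))" using fin by (simp add: card_SigmaI)
  finally have "card ?EB \<le> (\<Sum>k\<le>?N. card (B k))" .
  moreover have "(\<Sum>k\<le>?N. h k) = card ?EB"
    using sum.group[of ?EB "{..?N}" "deg X" "\<lambda>_. 1::nat"] finite_extracted_bases
    by (simp add: h_def image_subset_iff)
  moreover have "(\<Sum>k\<le>?N. card (B k)) \<le> (\<Sum>k\<le>?N. h k)" by (intro sum_mono le)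
  ultimately have sum_eq: "(\<Sum>k\<le>?N. card (B k)) = (\<Sum>k\<le>?N. h k)" by simp
  have dim: "fs.dim (?D k) = h k" for k
  proof (cases "k \<le> ?N")
    case True
    then show ?thesis using sum_mono_inv[OF sum_eq le, of k] B(4) by simp
  next
    case False
    then show ?thesis using h0[of k] B0[of k] B(4)[of k] by simp
  qed
  show ?thesis
  proof (rule fps_ext)
    fix k
    have "fps_nth (\<Sum>b\<in>?EB. fps_X ^ deg X b :: int fps) k = (\<Sum>b\<in>?EB. if k = deg X b then 1 else 0)"
      by (simp add: fps_sum_nth fps_X_power_nth)
    also have "\<dots> = int (h k)"
      using finite_extracted_bases by (simp add: h_def sum.If_cases Int_def eq_commute)
    finally show "fps_nth (hilbert_series scale X) k = fps_nth (\<Sum>b\<in>?EB. fps_X ^ deg X b) k"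
      by (simp add: hilbert_series_def dim)
  qed
qed

end

theorem theorem6p2:
  fixes smult_V :: "complex \<Rightarrow> 'v::ab_group_add \<Rightarrow> 'v"
    and X :: "'v list" and s N :: nat
  assumes "vector_space smult_V"
    and "vector_space.dim smult_V (UNIV :: 'v set) = s"
    and "length X = N"
    and "0 \<notin> set X"
    and "module.span smult_V (set X) = UNIV"
  shows "hilbert_series smult_V X =
           (\<Sum>b\<in>extracted_bases smult_V X. fps_X ^ (N - card (breaking smult_V X b)))"
proof -
  interpret complex_vector_space smult_V
    using assms(1) by (simp add: complex_vector_space_def)
  show ?thesis using hilbert_series_eq[OF assms(4)] assms(3) by simp
qed

end
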